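(* Let $m\ge 2$ and $N\ge 1$ be integers, let $\eta_k:\mathbb{R}\to\mathbb{R}$, $k=0,1,\dots,m$, be of class $\mathcal{C}^1$, let $i,j_1,\dots,j_m\in\{1,\dots,N\}$, and define vector fields $\psi_k:\mathbb{R}^N\to\mathbb{R}^N$ by $$\psi_1(z)=e_i\,\eta_1(z_{j_1})\int\eta_0(z_i)\,\mathrm{d}z_i,\qquad \psi_k(z)=e_i\,z_i\,\eta_k(z_{j_k}),\quad k=2,\dots,m-1,\qquad \psi_m(z)=e_i\,\eta_m(z_{j_m}),$$ where $\int\eta_0(z_i)\,\mathrm{d}z_i$ denotes an antiderivative of $\eta_0$ evaluated at $z_i$. If $j_k\neq i$ for all $k=1,\dots,m$, then for all $z\in\mathbb{R}^N$ $$\Big[\big[\dots\big[[\psi_m,\psi_{m-1}],\psi_{m-2}\big],\dots\big],\psi_1\Big](z)=e_i\,\eta_0(z_i)\prod_{k=1}^m\eta_k(z_{j_k}).$$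
   Context: $e_i\in\mathbb{R}^N$ is the $i$th unit vector and $z=[z_1,\dots,z_N]^\top$. The Lie bracket of $\mathcal{C}^1$ vector fields is $[f_1,f_2](z)=\frac{\partial f_2}{\partial z}(z)f_1(z)-\frac{\partial f_1}{\partial z}(z)f_2(z)$. For $m=2$ there are no middle vector fields and the left-hand side is $[\psi_2,\psi_1](z)$. *)

theory Defs
  imports "HOL-Analysis.Analysis"
begin

(* Sign convention: [f, g] = (Dg) f - (Df) g. As usual, the value is only meaningful at points
   where both fields are differentiable. *)
definition lie_bracket :: "(real^'n \<Rightarrow> real^'n) \<Rightarrow> (real^'n \<Rightarrow> real^'n) \<Rightarrow> real^'n \<Rightarrow> real^'n"
  where "lie_bracket f g z = jacobian g (at z) *v f z - jacobian f (at z) *v g z"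

(* [[...[[psi m, psi (m - 1)], psi (m - 2)], ...], psi 1]; the list is [m - 1, ..., 1]. *)
definition iterated_lie_bracket :: "nat \<Rightarrow> (nat \<Rightarrow> real^'n \<Rightarrow> real^'n) \<Rightarrow> real^'n \<Rightarrow> real^'n"
  where "iterated_lie_bracket m \<psi> = foldl lie_bracket (\<psi> m) (map \<psi> (rev [1..<m]))"

end

theory Submission
  imports Defs
begin

text \<open>
  Every bracket in the chain has the form \<open>[a e\<^sub>i, b h(z\<^sub>i) e\<^sub>i]\<close> where neither \<open>a\<close> nor \<open>b\<close> varies
  in the direction \<open>e\<^sub>i\<close>. The derivative of the first field along the second therefore vanishes,
  and the bracket is \<open>a b h'(z\<^sub>i) e\<^sub>i\<close>. With \<open>h = id\<close> each middle field contributes exactly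
  its factor \<open>\<eta>\<^sub>k\<close>; with \<open>h\<close> an antiderivative of \<open>\<eta>\<^sub>0\<close> the last one contributes \<open>\<eta>\<^sub>1 \<eta>\<^sub>0\<close>.
\<close>

text \<open>The vanishing of the partial derivative in \<open>z $ i\<close>, bundled with
  differentiability because \<open>jacobian\<close> is only meaningful for differentiable
  maps.\<close>

definition stationary_along :: "'n::finite \<Rightarrow> (real^'n \<Rightarrow> real) \<Rightarrow> real^'n \<Rightarrow> bool"
  where "stationary_along i a z \<longleftrightarrow> (\<exists>a'. (a has_derivative a') (at z) \<and> a' (axis i 1) = 0)"

lemma stationary_along_mult:
  assumes "stationary_along i a z" "stationary_along i b z"
  shows "stationary_along i (\<lambda>z. a z * b z) z"
proof -
  obtain a' b' where "(a has_derivative a') (at z)" "a' (axis i 1) = 0"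
      and "(b has_derivative b') (at z)" "b' (axis i 1) = 0"
    using assms unfolding stationary_along_def by blast
  then show ?thesis
    unfolding stationary_along_def
    by (intro exI[of _ "\<lambda>v. a z * b' v + a' v * b z"]) (auto intro: has_derivative_mult)
qed

lemma stationary_along_prod:
  assumes "\<And>k. k \<in> A \<Longrightarrow> stationary_along i (f k) z"
  shows "stationary_along i (\<lambda>z. \<Prod>k\<in>A. f k z) z"
  using assms
proof (induction A rule: infinite_finite_induct)
  case (insert k A)
  then show ?case by (simp add: stationary_along_mult)
\<comment> \<open>For \<open>A\<close> infinite or empty the product is the constant 1, whose
  derivative is zero.\<close>
qed (auto simp: stationary_along_def intro!: exI[of _ "\<lambda>_. 0"])

lemma has_derivative_nth_comp:
  assumes "(h has_real_derivative d) (at (z $ l))"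
  shows "((\<lambda>z. h (z $ l)) has_derivative (\<lambda>v. d * (v $ l))) (at z)"
proof -
  have "((\<lambda>z. z $ l) has_derivative (\<lambda>v. v $ l)) (at z)"
    by (intro bounded_linear_imp_has_derivative bounded_linear_vec_nth)
  from has_derivative_compose[OF this assms[unfolded has_field_derivative_def]]
  show ?thesis .
qed

lemma stationary_along_nth_comp:
  assumes "h differentiable (at (z $ l))" "l \<noteq> i"
  shows "stationary_along i (\<lambda>z. h (z $ l)) z"
proof -
  obtain d where "(h has_real_derivative d) (at (z $ l))"
    using assms(1) by (auto simp: real_differentiable_def)
  then show ?thesis
    unfolding stationary_along_def
    using has_derivative_nth_comp[of h d z l] assms(2)
    by (intro exI[of _ "\<lambda>v. d * (v $ l)"]) (auto simp: axis_def)
qed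

text \<open>Turns the matrices in \<open>lie_bracket\<close> into directional derivatives of scalar
  coefficients: by uniqueness of derivatives the Jacobian acts as the rank-one map sending
  \<open>v\<close> to \<open>\<phi>' v\<close> times the axis.\<close>

lemma jacobian_mult_axis:
  fixes \<phi> :: "real^'n \<Rightarrow> real"
  assumes "(\<phi> has_derivative \<phi>') (at z)"
  shows "jacobian (\<lambda>z. \<phi> z *\<^sub>R axis i 1) (at z) *v (c *\<^sub>R axis k 1) = (c * \<phi>' (axis k 1)) *\<^sub>R (axis i 1 :: real^'n)"
proof -
  have der: "((\<lambda>z. \<phi> z *\<^sub>R axis i 1) has_derivative (\<lambda>v. \<phi>' v *\<^sub>R (axis i 1 :: real^'n))) (at z)"
    using assms by (rule has_derivative_scaleR_left)
  then have "((\<lambda>z. \<phi> z *\<^sub>R axis i 1) has_derivative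
      (*v) (jacobian (\<lambda>z. \<phi> z *\<^sub>R (axis i 1 :: real^'n)) (at z))) (at z)"
    by (simp add: jacobian_works[symmetric] differentiable_def) blast
  from fun_cong[OF has_derivative_unique[OF this der], of "c *\<^sub>R axis k 1"]
  show ?thesis
    by (simp add: linear_scale[OF has_derivative_linear[OF assms]])
qed

text \<open>In the product rule only the term differentiating \<open>h\<close> survives along
  \<open>axis i 1\<close>.\<close>

lemma lie_bracket_axis:
  assumes a: "stationary_along i a z" and b: "stationary_along i b z"
    and h: "(h has_real_derivative d) (at (z $ i))"
  shows "lie_bracket (\<lambda>z. a z *\<^sub>R axis i 1) (\<lambda>z. (b z * h (z $ i)) *\<^sub>R axis i 1) z
    = (d * (b z * a z)) *\<^sub>R axis i 1"
proof -
  obtain a' b' where a': "(a has_derivative a') (at z)" "a' (axis i 1) = 0"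
      and b': "(b has_derivative b') (at z)" "b' (axis i 1) = 0"
    using a b unfolding stationary_along_def by blast
  show ?thesis
    unfolding lie_bracket_def
      jacobian_mult_axis[OF has_derivative_mult[OF b'(1) has_derivative_nth_comp[OF h]]]
      jacobian_mult_axis[OF a'(1)]
    using a'(2) b'(2) by (simp add: axis_def mult_ac)
qed

theorem proposition2:
  fixes m :: nat
    and \<eta> :: "nat \<Rightarrow> real \<Rightarrow> real"
    and H :: "real \<Rightarrow> real"
    and i :: "'n::finite"
    and j :: "nat \<Rightarrow> 'n"
    and \<psi> :: "nat \<Rightarrow> real^'n \<Rightarrow> real^'n"
  assumes "m \<ge> 2"
    and "\<And>k. k \<le> m \<Longrightarrow> \<eta> k C1_differentiable_on UNIV"
    and "\<And>x. (H has_real_derivative \<eta> 0 x) (at x)"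
    and "\<And>z. \<psi> 1 z = (\<eta> 1 (z $ j 1) * H (z $ i)) *\<^sub>R axis i 1"
    and "\<And>k z. k \<in> {2..m-1} \<Longrightarrow> \<psi> k z = (z $ i * \<eta> k (z $ j k)) *\<^sub>R axis i 1"
    and "\<And>z. \<psi> m z = \<eta> m (z $ j m) *\<^sub>R axis i 1"
    and "\<And>k. k \<in> {1..m} \<Longrightarrow> j k \<noteq> i"
  shows "\<forall>z. iterated_lie_bracket m \<psi> z = (\<eta> 0 (z $ i) * (\<Prod>k=1..m. \<eta> k (z $ j k))) *\<^sub>R axis i 1"
proof
  fix z
  define e where "e = (axis i 1 :: real^'n)"
  \<comment> \<open>The tail product from \<open>k\<close> is the coefficient of the partial bracket
    of the fields \<open>m\<close> down to \<open>k\<close>.\<close>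
  define P where "P k z = (\<Prod>l=k..m. \<eta> l (z $ j l))" for k and z :: "real^'n"
  have stat: "stationary_along i (\<lambda>z. \<eta> k (z $ j k)) z" if "k \<in> {1..m}" for k z
    using assms(2)[of k] assms(7)[of k] that
    by (intro stationary_along_nth_comp) (auto simp: C1_differentiable_on_eq)
  have statP: "stationary_along i (P k) z" if "k \<ge> 1" for k z
    unfolding P_def using stat that by (intro stationary_along_prod) auto
  have P_step: "P k z = \<eta> k (z $ j k) * P (Suc k) z" if "k < m" for k z
    unfolding P_def using that by (simp add: prod.atLeast_Suc_atMost)
  \<comment> \<open>Lowering the bound appends \<open>k\<close> at the end of the list, so
    \<open>foldl\<close> adds one outermost bracket.\<close>
  have upt: "rev [k..<m] = rev [Suc k..<m] @ [k]" if "k < m" for k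
    using that by (simp add: upt_conv_Cons)
  \<comment> \<open>Downward induction from \<open>m\<close>, where the list is empty. It stops at
    2, since \<open>\<psi> 1\<close> carries \<open>H\<close> instead of the coordinate; for
    \<open>m = 2\<close> only the base case occurs.\<close>
  have middle: "foldl lie_bracket (\<psi> m) (map \<psi> (rev [k..<m])) = (\<lambda>z. P k z *\<^sub>R e)"
    if "2 \<le> k" "k \<le> m" for k
    using that(2,1)
  proof (induction rule: inc_induct)
    case base
    then show ?case using assms(6) by (auto simp: P_def e_def)
  next
    case (step n)
    \<comment> \<open>The factors are swapped to match \<open>lie_bracket_axis\<close> with
      \<open>h\<close> the identity and \<open>d = 1\<close>.\<close>
    have \<psi>n: "\<psi> n = (\<lambda>z. (\<eta> n (z $ j n) * z $ i) *\<^sub>R e)"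
      using assms(5)[of n] step by (auto simp: e_def mult_ac)
    have "lie_bracket (\<lambda>z. P (Suc n) z *\<^sub>R e) (\<psi> n) z = P n z *\<^sub>R e" for z
      unfolding \<psi>n e_def
      using lie_bracket_axis[OF statP stat DERIV_ident, of "Suc n" n z] step
      by (simp add: P_step)
    then show ?case
      \<comment> \<open>Extensionality is restricted to equations headed by a bracket, so that the
        induction hypothesis still rewrites as an equation of functions.\<close>
      using step.IH upt[OF step.hyps(2)] step.prems by (simp add: fun_eq_iff[of "lie_bracket _ _"])
  qed
  have \<psi>1: "\<psi> 1 = (\<lambda>z. (\<eta> 1 (z $ j 1) * H (z $ i)) *\<^sub>R e)"
    using assms(4) by (auto simp: e_def)
  have "iterated_lie_bracket m \<psi> z = lie_bracket (\<lambda>z. P 2 z *\<^sub>R e) (\<psi> 1) z"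
    unfolding iterated_lie_bracket_def
    using upt[of 1] middle[of 2] assms(1) by (simp add: numeral_2_eq_2)
  \<comment> \<open>Here \<open>h\<close> is \<open>H\<close> and \<open>d\<close> is
    \<open>\<eta> 0 (z $ i)\<close>; \<open>P_step\<close> absorbs the factor
    \<open>\<eta> 1\<close> into \<open>P 1\<close>.\<close>
  also have "\<dots> = (\<eta> 0 (z $ i) * P 1 z) *\<^sub>R e"
    unfolding \<psi>1 e_def
    using lie_bracket_axis[OF statP stat assms(3), of 2 1 z] assms(1) P_step[of 1 z]
    by (simp add: numeral_2_eq_2)
  finally show "iterated_lie_bracket m \<psi> z = (\<eta> 0 (z $ i) * (\<Prod>k=1..m. \<eta> k (z $ j k))) *\<^sub>R axis i 1"
    by (simp add: P_def e_def)
qed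

end
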